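(* Let $(A,T)$ be a topological algebra with unit $e\neq 0$. The following assertions are equivalent: (1) $(A,T)$ is a saturated locally multiplicatively convex algebra; (2) the topology $T$ is defined by a family $\{p_s: s\in S\}$ of submultiplicative seminorms such that (i) $p_s(e)=1$ for all $s\in S$; (ii) for all $x\in A$ and $s\in S$ with $p_s(x)=1$, there exists $f_0\in M^*(A)$ such that $|f_0(x)|=1$.
   Context: A topological algebra is an (associative, not necessarily commutative) algebra over $\mathbb{C}$ which is also a Hausdorff topological vector space such that the multiplication is separately continuous. $M^*(A)$ denotes the set of all nonzero multiplicative linear functionals $A\to\mathbb{C}$ (not necessarily continuous). A topological algebra $A$ with unit $e$ and $M^*(A)\neq\emptyset$ is called a saturated locally multiplicatively convex algebra if its topology is determined by a family $\{p_s:s\in S\}$ of submultiplicative seminorms such that (a) $p_s(e)=1$ for all $s\in S$, and (b) for all $x\in A$ and $s\in S$ with $p_s(x)=1$, there exist $f_0,f\in M^*(A)$ such that $|f_0(x)|=\sup\{|f(y)|: y\in A,\ p_s(y)\le 1\}$. *)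

theory Defs
  imports "HOL-Analysis.Analysis"
begin

locale complex_algebra = vector_space smul
  for smul :: "complex \<Rightarrow> 'a::ring \<Rightarrow> 'a" (infixr "*\<^sub>C" 75) +
  assumes scale_mult_left: "(c *\<^sub>C x) * y = c *\<^sub>C (x * y)"
    and scale_mult_right: "x * (c *\<^sub>C y) = c *\<^sub>C (x * y)"

locale topological_algebra = complex_algebra smul
  for smul :: "complex \<Rightarrow> 'a::ring \<Rightarrow> 'a" (infixr "*\<^sub>C" 75) +
  fixes T :: "'a topology"
  assumes topspace_UNIV: "topspace T = UNIV"
    and Hausdorff: "Hausdorff_space T"
    and continuous_add: "continuous_map (prod_topology T T) T (\<lambda>(x, y). x + y)"
    and continuous_scale: "continuous_map (prod_topology euclidean T) T (\<lambda>(c, x). c *\<^sub>C x)"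
    and continuous_mult_left: "continuous_map T T (\<lambda>x. a * x)"
    and continuous_mult_right: "continuous_map T T (\<lambda>x. x * a)"

definition mult_functionals :: "(complex \<Rightarrow> 'a::ring \<Rightarrow> 'a) \<Rightarrow> ('a \<Rightarrow> complex) set" where
  "mult_functionals smul =
    {f. Vector_Spaces.linear smul (*) f \<and> (\<forall>x y. f (x * y) = f x * f y) \<and> (\<exists>x. f x \<noteq> 0)}"

definition submult_seminorm :: "(complex \<Rightarrow> 'a::ring \<Rightarrow> 'a) \<Rightarrow> ('a \<Rightarrow> real) \<Rightarrow> bool" where
  "submult_seminorm smul p \<longleftrightarrow>
    (\<forall>x. 0 \<le> p x) \<and> (\<forall>x y. p (x + y) \<le> p x + p y) \<and>
    (\<forall>c x. p (smul c x) = cmod c * p x) \<and> (\<forall>x y. p (x * y) \<le> p x * p y)"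

text \<open>A family of seminorms is represented by the set of its members, since none of the
  conditions below depends on the indexing. The finite intersections of balls form a
  neighbourhood base at each point.\<close>

definition topology_defined_by :: "'a::ab_group_add topology \<Rightarrow> ('a \<Rightarrow> real) set \<Rightarrow> bool" where
  "topology_defined_by T P \<longleftrightarrow>
    (\<forall>U. openin T U \<longleftrightarrow>
      (\<forall>x\<in>U. \<exists>F r. finite F \<and> F \<subseteq> P \<and> 0 < r \<and> {y. \<forall>p\<in>F. p (y - x) < r} \<subseteq> U))"

text \<open>The supremum is taken in the extended reals: functionals in \<open>mult_functionals\<close> need not be
  bounded on the unit ball of a seminorm, and an unbounded one must not satisfy the equation.\<close>

definition saturated_lmc_algebra ::
    "(complex \<Rightarrow> 'a::ring_1 \<Rightarrow> 'a) \<Rightarrow> 'a topology \<Rightarrow> bool" where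
  "saturated_lmc_algebra smul T \<longleftrightarrow>
    topological_algebra smul T \<and> mult_functionals smul \<noteq> {} \<and>
    (\<exists>P. (\<forall>p\<in>P. submult_seminorm smul p) \<and> topology_defined_by T P \<and>
      (\<forall>p\<in>P. p 1 = 1) \<and>
      (\<forall>x. \<forall>p\<in>P. p x = 1 \<longrightarrow>
        (\<exists>f\<^sub>0\<in>mult_functionals smul. \<exists>f\<in>mult_functionals smul.
          ereal (cmod (f\<^sub>0 x)) = (SUP y\<in>{y. p y \<le> 1}. ereal (cmod (f y))))))"

end

theory Submission
  imports Defs
begin

text \<open>A multiplicative functional bounded on the unit ball of \<open>p\<close> is bounded there by \<open>1\<close>, as
  otherwise its values on powers would be unbounded; hence every finite supremum in the definition
  of saturation is \<open>1\<close>. For the converse one needs, for each \<open>p\<close>, a multiplicative functional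
  dominated by \<open>p\<close>. Commutators are killed by every multiplicative functional, so the hypothesis
  makes all seminorms vanish on them, and the algebra is commutative because its topology is
  Hausdorff. To avoid completions and maximal ideals, take by Zorn's lemma a minimal submultiplicative
  seminorm \<open>q \<le> p\<close> with \<open>q 1 = 1\<close>. Comparison with its spectral radius shows that \<open>q\<close> is
  compatible with powers, and comparison with \<open>y \<mapsto> lim q (x\<^sup>n y) / q x\<^sup>n\<close> that it is
  multiplicative. By the argument of Ostrowski's theorem every element is then a scalar modulo the
  kernel of \<open>q\<close>, and this scalar is the value of the functional.\<close>

section \<open>Submultiplicative seminorms and multiplicative functionals\<close>

lemma submult_seminormD:
  assumes "submult_seminorm smul p"
  shows "0 \<le> p x" "p (x + y) \<le> p x + p y" "p (smul c x) = cmod c * p x" "p (x * y) \<le> p x * p y"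
  using assms by (auto simp: submult_seminorm_def)

lemma submult_seminorm_power_le:
  fixes p :: "'a::ring_1 \<Rightarrow> real"
  assumes "submult_seminorm smul p" "p 1 = 1"
  shows "p (x ^ n) \<le> p x ^ n"
proof (induction n)
  case (Suc n)
  have "p (x * x ^ n) \<le> p x * p (x ^ n)"
    by (rule submult_seminormD[OF assms(1)])
  also have "\<dots> \<le> p x * p x ^ n"
    using Suc submult_seminormD(1)[OF assms(1)] by (simp add: mult_left_mono)
  finally show ?case by simp
qed (simp add: assms)

lemma mult_functional_one:
  assumes "f \<in> mult_functionals smul"
  shows "f (1::'a::ring_1) = 1"
proof -
  obtain x where "f x \<noteq> 0" "f (x * 1) = f x * f 1"
    using assms unfolding mult_functionals_def by blast
  then show ?thesis by simp
qed

lemma mult_functional_power: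
  assumes "f \<in> mult_functionals smul"
  shows "f ((x::'a::ring_1) ^ n) = f x ^ n"
proof (induction n)
  case (Suc n)
  then show ?case using assms by (simp add: mult_functionals_def)
qed (simp add: mult_functional_one[OF assms])

lemma mult_functional_cmod_le_one:
  fixes p :: "'a::ring_1 \<Rightarrow> real"
  assumes "f \<in> mult_functionals smul" "submult_seminorm smul p" "p 1 = 1"
    and bound: "\<And>y. p y \<le> 1 \<Longrightarrow> cmod (f y) \<le> c" and "p y \<le> 1"
  shows "cmod (f y) \<le> 1"
proof (rule ccontr)
  assume "\<not> ?thesis"
  then obtain n where "c < cmod (f y) ^ n"
    using real_arch_pow[of "cmod (f y)" c] by auto
  moreover have "p (y ^ n) \<le> 1"
    using submult_seminorm_power_le[OF assms(2,3), of y n] submult_seminormD(1)[OF assms(2), of y]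
      \<open>p y \<le> 1\<close> power_le_one[of "p y" n] by linarith
  ultimately show False
    using bound[of "y ^ n"] by (simp add: mult_functional_power[OF assms(1)] norm_power)
qed

text \<open>The unit lies in the ball and has value \<open>1\<close>, so the bound is
  attained.\<close>

lemma mult_functional_SUP_unit_ball:
  fixes p :: "'a::ring_1 \<Rightarrow> real"
  assumes "f \<in> mult_functionals smul" "p 1 = 1"
    and "\<And>y. p y \<le> 1 \<Longrightarrow> cmod (f y) \<le> 1"
  shows "(SUP y\<in>{y. p y \<le> 1}. ereal (cmod (f y))) = 1"
proof (rule antisym)
  show "(SUP y\<in>{y. p y \<le> 1}. ereal (cmod (f y))) \<le> 1"
    using assms(3) by (auto intro!: SUP_least)
  show "1 \<le> (SUP y\<in>{y. p y \<le> 1}. ereal (cmod (f y)))"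
    using assms(2) by (auto intro!: SUP_upper2[of 1] simp: mult_functional_one[OF assms(1)])
qed

text \<open>If all members of \<open>P\<close> vanish on \<open>y - x\<close>, every basic
  neighbourhood of \<open>x\<close> contains \<open>y\<close>. For \<open>P = {}\<close> the premise
  is vacuous, which later shows that the family is nonempty.\<close>

lemma topology_defined_by_separates:
  assumes "topology_defined_by T P" "Hausdorff_space T" "topspace T = UNIV"
    and "\<And>p. p \<in> P \<Longrightarrow> p (y - x) = 0"
  shows "x = y"
proof (rule ccontr)
  assume "x \<noteq> y"
  then obtain U V where UV: "openin T U" "openin T V" "x \<in> U" "y \<in> V" "disjnt U V"
    using assms(2) unfolding Hausdorff_space_def assms(3) by (metis UNIV_I)
  then obtain F r where F: "F \<subseteq> P" "0 < r" "{y. \<forall>p\<in>F. p (y - x) < r} \<subseteq> U"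
    using bspec[OF iffD1[OF spec[OF assms(1)[unfolded topology_defined_by_def]] UV(1)] UV(3)]
    by (elim exE conjE)
  have "\<forall>p\<in>F. p (y - x) < r"
  proof
    fix p assume "p \<in> F"
    then have "p (y - x) = 0" using F(1) by (intro assms(4)) auto
    then show "p (y - x) < r" using F(2) by simp
  qed
  then have "y \<in> U" using F(3) by auto
  then show False using UV by (auto simp: disjnt_def)
qed

section \<open>Commutative algebras and infima of seminorms\<close>

locale commutative_complex_algebra = complex_algebra smul
  for smul :: "complex \<Rightarrow> 'a::ring_1 \<Rightarrow> 'a" (infixr "*\<^sub>C" 75) +
  assumes mult_commute: "(x::'a) * y = y * x"
begin

lemma mult_left_commute: "(x::'a) * (y * z) = y * (x * z)"
  by (metis mult.assoc mult_commute)

lemmas mult_ac = mult.assoc mult_commute mult_left_commute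

lemma power_mult_distrib: "((x::'a) * y) ^ n = x ^ n * y ^ n"
  by (induction n) (simp_all add: mult_ac)

lemma power_smul: "(c *\<^sub>C x) ^ n = (c ^ n) *\<^sub>C (x ^ n)"
  by (induction n) (simp_all add: scale_mult_left scale_mult_right)

text \<open>\<open>S x\<close> collects candidate values at \<open>x\<close>, and each inequality
  need only hold up to a smaller candidate. This serves three constructions: the infimum of a chain,
  the spectral radius, and the limit along powers of a fixed element.\<close>

lemma submult_seminorm_Inf:
  assumes ne: "\<And>x. S x \<noteq> {}" and nonneg: "\<And>x s. s \<in> S x \<Longrightarrow> 0 \<le> s"
    and add: "\<And>x y s t. s \<in> S x \<Longrightarrow> t \<in> S y \<Longrightarrow> \<exists>u\<in>S (x + y). u \<le> s + t"
    and mult: "\<And>x y s t. s \<in> S x \<Longrightarrow> t \<in> S y \<Longrightarrow> \<exists>u\<in>S (x * y). u \<le> s * t"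
    and scale: "\<And>x c s. s \<in> S x \<Longrightarrow> \<exists>u\<in>S (c *\<^sub>C x). u \<le> cmod c * s"
  shows "submult_seminorm smul (\<lambda>x. Inf (S x))"
proof -
  have lower: "Inf (S x) \<le> s" if "u \<in> S x" "u \<le> s" for x u s
    using that nonneg by (intro cInf_lower2) (auto intro!: bdd_belowI)
  have pos: "0 \<le> Inf (S x)" for x
    using ne nonneg by (intro cInf_greatest) auto
  have approx: "\<exists>s\<in>S x. s < Inf (S x) + e" if "0 < e" for x e
    using cInf_lessD[OF ne, of x "Inf (S x) + e"] that by auto
  have scale_le: "Inf (S (c *\<^sub>C x)) \<le> cmod c * Inf (S x)" for c x
  proof (cases "c = 0")
    case True
    then show ?thesis using ne[of x] scale[of _ x c] lower by fastforce
  next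
    case False
    have "Inf (S (c *\<^sub>C x)) / cmod c \<le> Inf (S x)"
    proof (rule cInf_greatest[OF ne])
      fix s assume "s \<in> S x"
      then have "Inf (S (c *\<^sub>C x)) \<le> cmod c * s" using scale lower by meson
      then show "Inf (S (c *\<^sub>C x)) / cmod c \<le> s" using False by (simp add: field_simps)
    qed
    then show ?thesis using False by (simp add: field_simps)
  qed
  show ?thesis
    unfolding submult_seminorm_def
  proof (intro conjI allI)
    show "0 \<le> Inf (S x)" for x by (rule pos)
    show "Inf (S (x + y)) \<le> Inf (S x) + Inf (S y)" for x y
    proof (rule field_le_epsilon)
      fix e :: real assume "0 < e"
      then obtain s t where st: "s \<in> S x" "s < Inf (S x) + e/2" "t \<in> S y" "t < Inf (S y) + e/2"
        using approx[of "e/2"] by (meson half_gt_zero)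
      then have "Inf (S (x + y)) \<le> s + t" using add lower by meson
      then show "Inf (S (x + y)) \<le> Inf (S x) + Inf (S y) + e" using st by simp
    qed
    show "Inf (S (c *\<^sub>C x)) = cmod c * Inf (S x)" for c x
    proof (cases "c = 0")
      case True
      then show ?thesis using scale_le[of c x] pos[of "c *\<^sub>C x"] by auto
    next
      case False
      \<comment> \<open>Rescaling back by \<open>inverse c\<close> turns the upper estimate into the
        reverse one.\<close>
      have "Inf (S (inverse c *\<^sub>C c *\<^sub>C x)) \<le> cmod (inverse c) * Inf (S (c *\<^sub>C x))"
        by (rule scale_le)
      then have "cmod c * Inf (S x) \<le> Inf (S (c *\<^sub>C x))"
        using False by (simp add: norm_divide field_simps)
      then show ?thesis using scale_le[of c x] by simp
    qed
    show "Inf (S (x * y)) \<le> Inf (S x) * Inf (S y)" for x y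
    \<comment> \<open>Candidates within \<open>e\<close> of the two infima give a bound that tends
      to the product of the infima as \<open>e\<close> decreases to 0.\<close>
    proof (rule tendsto_le[of "at_right 0"])
      show "((\<lambda>e. (Inf (S x) + e) * (Inf (S y) + e)) \<longlongrightarrow> Inf (S x) * Inf (S y)) (at_right 0)"
        by (auto intro!: tendsto_eq_intros)
      show "\<forall>\<^sub>F e in at_right 0. Inf (S (x * y)) \<le> (Inf (S x) + e) * (Inf (S y) + e)"
        unfolding eventually_at_filter
      proof (intro always_eventually allI impI)
        fix e :: real assume "e \<in> {0<..}"
        then obtain s t where st: "s \<in> S x" "s < Inf (S x) + e" "t \<in> S y" "t < Inf (S y) + e"
          using approx by (meson greaterThan_iff)
        then have "Inf (S (x * y)) \<le> s * t" using mult lower by meson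
        also have "\<dots> \<le> (Inf (S x) + e) * (Inf (S y) + e)"
          using st nonneg[OF st(1)] nonneg[OF st(3)] by (intro mult_mono) auto
        finally show "Inf (S (x * y)) \<le> (Inf (S x) + e) * (Inf (S y) + e)" .
      qed
    qed auto
  qed
qed

section \<open>Minimal seminorms and the spectral radius\<close>

definition minimal_seminorm :: "('a \<Rightarrow> real) \<Rightarrow> bool" where
  "minimal_seminorm q \<longleftrightarrow> submult_seminorm smul q \<and> q 1 = 1 \<and>
    (\<forall>r. submult_seminorm smul r \<and> r 1 = 1 \<and> r \<le> q \<longrightarrow> r = q)"

lemma exists_minimal_seminorm:
  assumes p: "submult_seminorm smul p" "p 1 = 1"
  shows "\<exists>q. minimal_seminorm q \<and> q \<le> p"
proof -
  define Q where "Q = {q. submult_seminorm smul q \<and> q 1 = 1 \<and> q \<le> p}"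
  have "\<exists>m\<in>Q. \<forall>q\<in>Q. q \<le> m \<longrightarrow> q = m"
  \<comment> \<open>The order is reversed, so a maximal element is a minimal seminorm and chains
    require lower bounds.\<close>
  proof (rule predicate_Zorn)
    show "partial_order_on Q (relation_of (\<lambda>f g. g \<le> f) Q)"
      by (rule partial_order_on_relation_ofI) auto
    fix C assume "C \<in> Chains (relation_of (\<lambda>f g. g \<le> f) Q)"
    then have CQ: "C \<subseteq> Q" and chain: "\<And>f g. f \<in> C \<Longrightarrow> g \<in> C \<Longrightarrow> f \<le> g \<or> g \<le> f"
      unfolding Chains_def relation_of_def by blast+
    show "\<exists>u\<in>Q. \<forall>q\<in>C. u \<le> q"
    proof (cases "C = {}")
      case True
      then show ?thesis using p by (auto simp: Q_def)
    next
      case False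
      define u where "u = (\<lambda>x. Inf ((\<lambda>q. q x) ` C))"
      have sn: "submult_seminorm smul q" if "q \<in> C" for q using that CQ by (auto simp: Q_def)
      have lower: "u \<le> q" if "q \<in> C" for q
        unfolding u_def le_fun_def using that submult_seminormD(1)[OF sn]
        by (auto intro!: cINF_lower bdd_belowI)
      \<comment> \<open>\<open>s\<close> and \<open>t\<close> below may come from different members
        of the chain; the smaller of the two serves both.\<close>
      have directed: "\<exists>h\<in>C. h \<le> f \<and> h \<le> g" if "f \<in> C" "g \<in> C" for f g
        using chain that by blast
      have "submult_seminorm smul u"
        unfolding u_def
      proof (rule submult_seminorm_Inf)
        fix x y s t assume "s \<in> (\<lambda>q. q x) ` C" "t \<in> (\<lambda>q. q y) ` C"
        then obtain f g where fg: "f \<in> C" "g \<in> C" "s = f x" "t = g y" by auto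
        then obtain h where h: "h \<in> C" "h x \<le> s" "h y \<le> t"
          using directed unfolding le_fun_def by metis
        show "\<exists>u\<in>(\<lambda>q. q (x + y)) ` C. u \<le> s + t"
          using h submult_seminormD(2)[OF sn[OF h(1)], of x y] by (intro bexI[of _ "h (x + y)"]) auto
        have "h (x * y) \<le> h x * h y" by (rule submult_seminormD[OF sn[OF h(1)]])
        also have "\<dots> \<le> s * t"
          using h submult_seminormD(1)[OF sn[OF h(1)]] by (intro mult_mono) (auto intro: order_trans)
        finally show "\<exists>u\<in>(\<lambda>q. q (x * y)) ` C. u \<le> s * t" using h by auto
      qed (use False submult_seminormD[OF sn] in \<open>auto simp: image_iff\<close>)
      moreover have "u 1 = 1"
      proof -
        have "(\<lambda>q. q 1) ` C = {1}" using False CQ by (auto simp: Q_def)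
        then show ?thesis by (simp add: u_def)
      qed
      moreover have "u \<le> p"
        using False lower CQ unfolding Q_def by (blast intro: order_trans)
      ultimately show ?thesis using lower by (auto simp: Q_def)
    qed
  qed
  then obtain m where "m \<in> Q" "\<And>q. q \<in> Q \<Longrightarrow> q \<le> m \<Longrightarrow> q = m" by auto
  then show ?thesis
    unfolding minimal_seminorm_def Q_def by (blast intro: order_trans)
qed

text \<open>The infimum of this set is the spectral radius, the limit of the n-th roots of
  \<open>q (x ^ n)\<close>. Bounds with a constant \<open>M\<close> in place of roots let estimates
  for \<open>x\<close> and \<open>y\<close> be combined directly.\<close>

definition growth_rates :: "('a \<Rightarrow> real) \<Rightarrow> 'a \<Rightarrow> real set" where
  "growth_rates q x = {s. 0 \<le> s \<and> (\<exists>M. \<forall>n. q (x ^ n) \<le> M * s ^ n)}"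

lemma growth_ratesI: "0 \<le> s \<Longrightarrow> (\<And>n. q (x ^ n) \<le> M * s ^ n) \<Longrightarrow> s \<in> growth_rates q x"
  by (auto simp: growth_rates_def)

context
  fixes q assumes q: "submult_seminorm smul q" "q 1 = 1"
begin

lemmas q_simps = submult_seminormD[OF q(1)]

lemma growth_ratesE:
  assumes "s \<in> growth_rates q x"
  obtains M where "0 \<le> s" "0 \<le> M" "\<And>n. q (x ^ n) \<le> M * s ^ n"
proof -
  obtain M where M: "0 \<le> s" "\<And>n. q (x ^ n) \<le> M * s ^ n"
    using assms by (auto simp: growth_rates_def)
  moreover have "0 \<le> M" using M(2)[of 0] q(2) by simp
  ultimately show ?thesis using that by blast
qed

lemma q_in_growth_rates: "q x \<in> growth_rates q x"
  using submult_seminorm_power_le[OF q] q_simps(1) by (intro growth_ratesI[where M = 1]) auto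

lemma growth_rates_add:
  assumes "s \<in> growth_rates q x" "t \<in> growth_rates q y"
  shows "s + t \<in> growth_rates q (x + y)"
proof -
  obtain M where M: "0 \<le> s" "0 \<le> M" "\<And>n. q (x ^ n) \<le> M * s ^ n" using assms growth_ratesE by metis
  obtain N where N: "0 \<le> t" "0 \<le> N" "\<And>n. q (y ^ n) \<le> N * t ^ n" using assms growth_ratesE by metis
  \<comment> \<open>The spare factor \<open>x ^ k * y ^ l\<close> makes the induction work:
    splitting off one \<open>x + y\<close> raises \<open>k\<close> or \<open>l\<close> by one, as in
    the binomial theorem.\<close>
  have "q ((x + y) ^ n * (x ^ k * y ^ l)) \<le> M * N * (s + t) ^ n * s ^ k * t ^ l" for n k l
  proof (induction n arbitrary: k l)
    case 0
    have "q (x ^ k * y ^ l) \<le> q (x ^ k) * q (y ^ l)" by (rule q_simps)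
    also have "\<dots> \<le> (M * s ^ k) * (N * t ^ l)"
      using M N q_simps(1) by (intro mult_mono) auto
    finally show ?case by (simp add: ac_simps)
  next
    case (Suc n)
    have eq: "(x + y) ^ Suc n * (x ^ k * y ^ l) =
        (x + y) ^ n * (x ^ Suc k * y ^ l) + (x + y) ^ n * (x ^ k * y ^ Suc l)"
      unfolding power_Suc2[of "x + y"] by (simp add: algebra_simps mult_left_commute)
    have "q ((x + y) ^ Suc n * (x ^ k * y ^ l)) \<le>
        q ((x + y) ^ n * (x ^ Suc k * y ^ l)) + q ((x + y) ^ n * (x ^ k * y ^ Suc l))"
      unfolding eq by (rule q_simps)
    also have "\<dots> \<le> M * N * (s + t) ^ n * s ^ Suc k * t ^ l + M * N * (s + t) ^ n * s ^ k * t ^ Suc l"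
      by (intro add_mono Suc.IH)
    finally show ?case by (simp add: algebra_simps)
  qed
  from this[of _ 0 0] show ?thesis
    using M N by (intro growth_ratesI[where M = "M * N"]) auto
qed

lemma growth_rates_mult:
  assumes "s \<in> growth_rates q x" "t \<in> growth_rates q y"
  shows "s * t \<in> growth_rates q (x * y)"
proof -
  obtain M where M: "0 \<le> s" "0 \<le> M" "\<And>n. q (x ^ n) \<le> M * s ^ n" using assms growth_ratesE by metis
  obtain N where N: "0 \<le> t" "0 \<le> N" "\<And>n. q (y ^ n) \<le> N * t ^ n" using assms growth_ratesE by metis
  have "q ((x * y) ^ n) \<le> M * N * (s * t) ^ n" for n
  proof -
    have "q ((x * y) ^ n) \<le> q (x ^ n) * q (y ^ n)"
      unfolding power_mult_distrib by (rule q_simps)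
    also have "\<dots> \<le> (M * s ^ n) * (N * t ^ n)"
      using M N q_simps(1) by (intro mult_mono) auto
    finally show ?thesis by (simp add: Power.power_mult_distrib ac_simps)
  qed
  then show ?thesis using M N by (intro growth_ratesI[where M = "M * N"]) auto
qed

lemma growth_rates_scale:
  assumes "s \<in> growth_rates q x"
  shows "cmod c * s \<in> growth_rates q (c *\<^sub>C x)"
proof -
  obtain M where M: "0 \<le> s" "0 \<le> M" "\<And>n. q (x ^ n) \<le> M * s ^ n" using assms growth_ratesE by metis
  have "q ((c *\<^sub>C x) ^ n) \<le> M * (cmod c * s) ^ n" for n
    using mult_left_mono[OF M(3), of "cmod c ^ n"]
    by (simp add: power_smul q_simps norm_power Power.power_mult_distrib ac_simps)
  then show ?thesis using M by (intro growth_ratesI[where M = M]) auto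
qed

lemma submult_seminorm_spectral_radius:
  "submult_seminorm smul (\<lambda>x. Inf (growth_rates q x))"
proof (rule submult_seminorm_Inf)
  show "growth_rates q x \<noteq> {}" for x using q_in_growth_rates by blast
  show "0 \<le> s" if "s \<in> growth_rates q x" for x s using that growth_ratesE by metis
qed (blast intro: growth_rates_add growth_rates_mult growth_rates_scale)+

lemma spectral_radius_le: "s \<in> growth_rates q x \<Longrightarrow> Inf (growth_rates q x) \<le> s"
  by (rule cInf_lower) (auto intro!: bdd_belowI[of _ 0] simp: growth_rates_def)

lemma spectral_radius_one: "Inf (growth_rates q 1) = 1"
proof (rule antisym)
  show "Inf (growth_rates q 1) \<le> 1"
    using spectral_radius_le[OF q_in_growth_rates, of 1] q by simp
  \<comment> \<open>For \<open>s < 1\<close> the bounds \<open>M * s ^ n\<close> tend to 0, but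
    \<open>q (1 ^ n)\<close> is always \<open>1\<close>.\<close>
  have "1 \<le> s" if "s \<in> growth_rates q 1" for s
  proof (rule ccontr)
    assume "\<not> 1 \<le> s"
    from that obtain M where M: "0 \<le> s" "\<And>n. q (1 ^ n) \<le> M * s ^ n" using growth_ratesE by metis
    have "(\<lambda>n. M * s ^ n) \<longlonglongrightarrow> M * 0"
      using M(1) \<open>\<not> 1 \<le> s\<close> by (intro tendsto_intros LIMSEQ_power_zero) auto
    then have "1 \<le> M * 0"
      using M(2) q(2) by (intro LIMSEQ_le_const) auto
    then show False by simp
  qed
  then show "1 \<le> Inf (growth_rates q 1)"
    using q_in_growth_rates by (intro cInf_greatest) auto
qed

end

section \<open>Multiplicativity of a minimal seminorm\<close>

context
  fixes q assumes min: "minimal_seminorm q"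
begin

lemma minimal_submult: "submult_seminorm smul q" and minimal_one: "q 1 = 1"
  using min by (auto simp: minimal_seminorm_def)

lemmas minimal_simps = submult_seminormD[OF minimal_submult]

lemma minimal_eqI:
  assumes "submult_seminorm smul r" "r 1 = 1" "\<And>x. r x \<le> q x"
  shows "r = q"
  using min assms by (auto simp: minimal_seminorm_def le_fun_def)

text \<open>The spectral radius is a submultiplicative seminorm below \<open>q\<close> with value
  \<open>1\<close> at the unit, so minimality applies.\<close>

lemma spectral_radius_minimal: "Inf (growth_rates q x) = q x"
proof -
  note q = minimal_submult minimal_one
  have "(\<lambda>x. Inf (growth_rates q x)) = q"
    by (rule minimal_eqI submult_seminorm_spectral_radius[OF q] spectral_radius_one[OF q]
        spectral_radius_le[OF q] q_in_growth_rates[OF q])+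
  then show ?thesis by (rule fun_cong)
qed

text \<open>A strict drop at one exponent \<open>k\<close> propagates to all powers of
  \<open>x\<close> through division with remainder by \<open>k\<close>, pushing the spectral radius
  below \<open>q x\<close>.\<close>

lemma minimal_power: "q (x ^ k) = q x ^ k"
proof (rule ccontr)
  note q = minimal_submult minimal_one
  assume "q (x ^ k) \<noteq> q x ^ k"
  then have less: "q (x ^ k) < q x ^ k"
    using submult_seminorm_power_le[OF q, of x k] by simp
  then have "0 < k" by (cases "k = 0") (simp_all add: q)
  \<comment> \<open>The midpoint is positive even when \<open>q (x ^ k) = 0\<close>, so its root
    \<open>s\<close> can be divided by.\<close>
  define v where "v = (q (x ^ k) + q x ^ k) / 2"
  define s where "s = root k v"
  have v: "0 < v" "q (x ^ k) \<le> v" "v < q x ^ k"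
    using less minimal_simps(1)[of "x ^ k"] by (auto simp: v_def)
  then have s: "0 < s" "s ^ k = v" using \<open>0 < k\<close> by (auto simp: s_def)
  then have "s < q x" using v minimal_simps(1) by (intro power_less_imp_less_base[of s k]) auto
  \<comment> \<open>The constant absorbs the remainder \<open>n mod k < k\<close>, since
    \<open>q x / s\<close> exceeds \<open>1\<close>.\<close>
  have "q (x ^ n) \<le> (q x / s) ^ k * s ^ n" for n
  proof -
    have "q (x ^ n) = q ((x ^ k) ^ (n div k) * x ^ (n mod k))"
      by (simp flip: power_mult power_add)
    also have "\<dots> \<le> q ((x ^ k) ^ (n div k)) * q (x ^ (n mod k))" by (rule minimal_simps)
    also have "\<dots> \<le> q (x ^ k) ^ (n div k) * q x ^ (n mod k)"
      using minimal_simps(1) by (intro mult_mono submult_seminorm_power_le[OF q]) auto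
    also have "\<dots> \<le> (s ^ k) ^ (n div k) * q x ^ (n mod k)"
      using minimal_simps(1) v s by (intro mult_right_mono power_mono) auto
    also have "\<dots> = (q x / s) ^ (n mod k) * ((s ^ k) ^ (n div k) * s ^ (n mod k))"
      using s by (simp add: power_divide)
    also have "(s ^ k) ^ (n div k) * s ^ (n mod k) = s ^ n"
      by (simp flip: power_mult power_add)
    also have "(q x / s) ^ (n mod k) * s ^ n \<le> (q x / s) ^ k * s ^ n"
      using s \<open>s < q x\<close> \<open>0 < k\<close> by (intro mult_right_mono power_increasing) (auto simp: less_imp_le)
    finally show ?thesis .
  qed
  then have "s \<in> growth_rates q x" using s by (intro growth_ratesI) auto
  from spectral_radius_le[OF q this] show False
    using \<open>s < q x\<close> by (simp add: spectral_radius_minimal)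
qed

text \<open>The quotients \<open>q (x ^ n * y) / q x ^ n\<close> decrease in \<open>n\<close>, and
  their infimum competes with \<open>q\<close> for minimality. It therefore equals \<open>q\<close>,
  and the term with \<open>n = 1\<close> gives the missing inequality.\<close>

lemma minimal_mult: "q (x * y) = q x * q y"
proof (cases "q x = 0")
  case True
  then show ?thesis using minimal_simps(1)[of "x * y"] minimal_simps(4)[of x y] by simp
next
  case False
  then have x: "0 < q x" using minimal_simps(1)[of x] by simp
  define S where "S y = range (\<lambda>n. q (x ^ n * y) / q x ^ n)" for y
  have decr: "q (x ^ (n + m) * y) / q x ^ (n + m) \<le> q (x ^ n * y) / q x ^ n" for n m y
  proof -
    have "q (x ^ (n + m) * y) = q (x ^ m * (x ^ n * y))"
      by (simp add: power_add mult_ac)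
    also have "\<dots> \<le> q x ^ m * q (x ^ n * y)"
      using minimal_simps(4)[of "x ^ m" "x ^ n * y"] by (simp add: minimal_power)
    finally show ?thesis using x by (simp add: field_simps power_add)
  qed
  have lower: "Inf (S y) \<le> q (x ^ n * y) / q x ^ n" for y n
    unfolding S_def using minimal_simps(1) x
    by (intro cINF_lower bdd_belowI[of _ 0]) auto
  have "(\<lambda>y. Inf (S y)) = q"
  proof (rule minimal_eqI)
    show "submult_seminorm smul (\<lambda>y. Inf (S y))"
    proof (rule submult_seminorm_Inf)
      fix y z s t assume "s \<in> S y" "t \<in> S z"
      then obtain n m where nm: "s = q (x ^ n * y) / q x ^ n" "t = q (x ^ m * z) / q x ^ m"
        by (auto simp: S_def)
      \<comment> \<open>Both candidates move to a common exponent, where \<open>decr\<close> only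
        lowers them; the second is written \<open>m + n\<close> to match it.\<close>
      have "q (x ^ (n + m) * (y + z)) / q x ^ (n + m) \<le>
          q (x ^ (n + m) * y) / q x ^ (n + m) + q (x ^ (m + n) * z) / q x ^ (m + n)"
        using minimal_simps(2)[of "x ^ (n + m) * y" "x ^ (n + m) * z"] x
        by (simp add: distrib_left add.commute[of m] divide_right_mono flip: add_divide_distrib)
      also have "\<dots> \<le> s + t" unfolding nm by (intro add_mono decr)
      finally show "\<exists>u\<in>S (y + z). u \<le> s + t" unfolding S_def by blast
      have "x ^ (n + m) * (y * z) = (x ^ n * y) * (x ^ m * z)"
        by (simp add: power_add mult_ac)
      then have "q (x ^ (n + m) * (y * z)) / q x ^ (n + m) \<le> s * t"
        using minimal_simps(4)[of "x ^ n * y" "x ^ m * z"] x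
        by (simp add: nm power_add divide_right_mono)
      then show "\<exists>u\<in>S (y * z). u \<le> s * t" unfolding S_def by blast
    qed (use minimal_simps x in \<open>auto simp: S_def scale_mult_right\<close>)
    show "Inf (S 1) = 1" using x by (simp add: S_def minimal_power)
    show "Inf (S y) \<le> q y" for y using lower[of y 0] by simp
  qed
  then have "q y \<le> q (x * y) / q x" using lower[of y 1] by (metis power_one_right)
  then show ?thesis using x minimal_simps(4)[of x y] by (simp add: field_simps)
qed

section \<open>Elements as scalars modulo the kernel\<close>

lemma minimal_of_scalar: "q (c *\<^sub>C 1) = cmod c"
  by (simp add: minimal_simps minimal_one)

text \<open>For \<open>N\<close> a power of two, \<open>b\<^sup>N - w\<^sup>N\<close> splits into \<open>b - w\<close> and \<open>N - 1\<close> further factors of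
  value at least \<open>q b\<close>; now let \<open>N\<close> tend to infinity.\<close>

lemma minimum_attained_on_disc:
  assumes pos: "0 < q b" and least: "\<And>w. q b \<le> q (b - w *\<^sub>C 1)" and w: "cmod w < q b"
  shows "q (b - w *\<^sub>C 1) = q b"
proof (rule ccontr)
  have split: "b ^ (2 * N) - (v * v) *\<^sub>C 1 = (b ^ N - v *\<^sub>C 1) * (b ^ N - (- v) *\<^sub>C 1)" for N v
    unfolding mult_2 power_add by (simp add: algebra_simps scale_mult_left scale_mult_right)
  \<comment> \<open>Taking square roots of \<open>u\<close> halves the exponent at each stage until
    \<open>least\<close> applies.\<close>
  have lower: "q b ^ 2 ^ k \<le> q (b ^ 2 ^ k - u *\<^sub>C 1)" for k u
  proof (induction k arbitrary: u)
    case 0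
    then show ?case using least by simp
  next
    case (Suc k)
    have "q b ^ 2 ^ k * q b ^ 2 ^ k \<le> q (b ^ 2 ^ k - csqrt u *\<^sub>C 1) * q (b ^ 2 ^ k - (- csqrt u) *\<^sub>C 1)"
      using pos by (intro mult_mono Suc.IH) (auto simp: minimal_simps)
    also have "\<dots> = q (b ^ 2 ^ Suc k - (csqrt u * csqrt u) *\<^sub>C 1)"
      unfolding power_Suc split minimal_mult ..
    finally show ?case by (simp add: mult_2 power_add flip: power2_eq_square)
  qed
  \<comment> \<open>Each doubling of the exponent adds the factor
    \<open>b ^ 2 ^ k - (- (w ^ 2 ^ k)) *\<^sub>C 1\<close>, bounded below by
    \<open>lower\<close>.\<close>
  have main: "q (b - w *\<^sub>C 1) * q b ^ 2 ^ k \<le> q b * q (b ^ 2 ^ k - (w ^ 2 ^ k) *\<^sub>C 1)" for k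
  proof (induction k)
    case (Suc k)
    have "(q (b - w *\<^sub>C 1) * q b ^ 2 ^ k) * q b ^ 2 ^ k \<le>
        (q b * q (b ^ 2 ^ k - (w ^ 2 ^ k) *\<^sub>C 1)) * q (b ^ 2 ^ k - (- (w ^ 2 ^ k)) *\<^sub>C 1)"
      using pos by (intro mult_mono Suc.IH lower) (auto simp: minimal_simps)
    also have "\<dots> = q b * q (b ^ 2 ^ Suc k - (w ^ 2 ^ k * w ^ 2 ^ k) *\<^sub>C 1)"
      unfolding power_Suc split minimal_mult by simp
    finally show ?case by (simp add: mult_2 power_add mult.assoc)
  qed simp
  assume "q (b - w *\<^sub>C 1) \<noteq> q b"
  then have "0 < q (b - w *\<^sub>C 1) / q b - 1" using least[of w] pos by simp
  then obtain n where n: "(cmod w / q b) ^ n < q (b - w *\<^sub>C 1) / q b - 1"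
    using real_arch_pow_inv[of "q (b - w *\<^sub>C 1) / q b - 1" "cmod w / q b"] w pos by auto
  have "q (b ^ 2 ^ n - (w ^ 2 ^ n) *\<^sub>C 1) \<le> q b ^ 2 ^ n + cmod w ^ 2 ^ n"
    using minimal_simps(2)[of "b ^ 2 ^ n" "(- (w ^ 2 ^ n)) *\<^sub>C 1"] minimal_of_scalar[of "- (w ^ 2 ^ n)"]
    by (simp add: minimal_power norm_power)
  then have "q (b - w *\<^sub>C 1) * q b ^ 2 ^ n \<le> q b * (q b ^ 2 ^ n + cmod w ^ 2 ^ n)"
    using main[of n] pos by (meson mult_left_mono less_imp_le order_trans)
  then have "q (b - w *\<^sub>C 1) / q b - 1 \<le> (cmod w / q b) ^ 2 ^ n"
    using pos by (simp add: field_simps power_divide)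
  also have "\<dots> \<le> (cmod w / q b) ^ n"
    using w pos by (intro power_decreasing) auto
  finally show False using n by simp
qed

text \<open>A minimum of \<open>q (a - z *\<^sub>C 1)\<close> over \<open>z\<close> exists by
  compactness. If positive, it would persist under translations of fixed length, hence arbitrarily
  far out, where \<open>far\<close> forces large values.\<close>

lemma minimal_scalar_approx: "\<exists>z. q (a - z *\<^sub>C 1) = 0"
proof -
  have lip: "q (a - z *\<^sub>C 1) \<le> q (a - w *\<^sub>C 1) + cmod (z - w)" for z w
    using minimal_simps(2)[of "a - w *\<^sub>C 1" "(w - z) *\<^sub>C 1"]
      minimal_of_scalar[of "w - z"]
    by (simp add: norm_minus_commute scale_left_diff_distrib)
  have far: "cmod z \<le> q a + q (a - z *\<^sub>C 1)" for z
  proof -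
    have "cmod z \<le> q (z *\<^sub>C 1 - a) + q a"
      using minimal_simps(2)[of "z *\<^sub>C 1 - a" a] by (simp add: minimal_of_scalar)
    moreover have "q (z *\<^sub>C 1 - a) = q (a - z *\<^sub>C 1)"
      using minimal_simps(3)[of "-1" "a - z *\<^sub>C 1"] by simp
    ultimately show ?thesis by simp
  qed
  \<comment> \<open>Outside this ball \<open>far\<close> gives values above \<open>q a\<close>, the
    value at \<open>z = 0\<close>, so the minimum over the ball is global.\<close>
  have "continuous_on (cball 0 (2 * q a)) (\<lambda>z. q (a - z *\<^sub>C 1))"
  proof (rule continuous_onI)
    fix z e :: complex and d :: real assume "0 < d"
    have "dist (q (a - y *\<^sub>C 1)) (q (a - z *\<^sub>C 1)) \<le> dist y z" for y
      using lip[of y z] lip[of z y] by (simp add: dist_norm norm_minus_commute abs_le_iff)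
    then show "\<exists>e>0. \<forall>y\<in>cball 0 (2 * q a). dist y z < e \<longrightarrow>
        dist (q (a - y *\<^sub>C 1)) (q (a - z *\<^sub>C 1)) \<le> d"
      using \<open>0 < d\<close> by (meson less_imp_le order_trans)
  qed
  then obtain z0 where z0: "\<And>z. cmod z \<le> 2 * q a \<Longrightarrow> q (a - z0 *\<^sub>C 1) \<le> q (a - z *\<^sub>C 1)"
    using continuous_attains_inf[of "cball 0 (2 * q a)" "\<lambda>z. q (a - z *\<^sub>C 1)"]
      minimal_simps(1)[of a] by (auto simp: Ball_def)
  define m where "m = q (a - z0 *\<^sub>C 1)"
  have least: "m \<le> q (a - z *\<^sub>C 1)" for z
  proof (cases "cmod z \<le> 2 * q a")
    case False
    have "m \<le> q a" unfolding m_def using z0[of 0] minimal_simps(1)[of a] by simp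
    then show ?thesis using far[of z] False by simp
  qed (simp add: m_def z0)
  have "m = 0"
  proof (rule ccontr)
    assume "m \<noteq> 0"
    then have m: "0 < m" using minimal_simps(1) by (simp add: m_def less_le)
    have shift: "a - (y + w) *\<^sub>C 1 = a - y *\<^sub>C 1 - w *\<^sub>C 1" for y w
      by (simp add: scale_left_distrib)
    \<comment> \<open>The step \<open>m / 2\<close> is shorter than \<open>m\<close>, so
      \<open>minimum_attained_on_disc\<close> applies afresh at each new centre.\<close>
    have eq: "q (a - (z0 + of_nat k * of_real (m / 2)) *\<^sub>C 1) = m" for k
    proof (induction k)
      case 0
      then show ?case by (simp add: m_def)
    next
      case (Suc k)
      define y where "y = z0 + of_nat k * complex_of_real (m / 2)"
      have y: "q (a - y *\<^sub>C 1) = m" using Suc y_def by simp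
      have "q (a - y *\<^sub>C 1 - complex_of_real (m / 2) *\<^sub>C 1) = q (a - y *\<^sub>C 1)"
        using m least by (intro minimum_attained_on_disc) (simp_all add: y flip: shift)
      moreover have "z0 + of_nat (Suc k) * complex_of_real (m / 2) = y + complex_of_real (m / 2)"
        by (simp add: y_def distrib_right)
      ultimately show ?case by (simp only: shift y)
    qed
    \<comment> \<open>After \<open>k\<close> steps the modulus exceeds \<open>q a + m\<close>, the
      most that \<open>far\<close> allows where the value is \<open>m\<close>.\<close>
    obtain k :: nat where k: "q a + m + cmod z0 < real k * (m / 2)"
      using reals_Archimedean3[of "m / 2"] m by (meson half_gt_zero)
    have "real k * (m / 2) = cmod (of_nat k * of_real (m / 2))"
      using m by (simp add: norm_mult)
    also have "\<dots> \<le> cmod (z0 + of_nat k * of_real (m / 2)) + cmod z0"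
      using norm_triangle_ineq4[of "z0 + of_nat k * of_real (m / 2)" z0] by simp
    also have "\<dots> \<le> q a + m + cmod z0"
      using far[of "z0 + of_nat k * of_real (m / 2)"] by (simp only: eq)
    finally show False using k by simp
  qed
  then show ?thesis unfolding m_def by blast
qed

text \<open>\<open>f a\<close> is the scalar that agrees with \<open>a\<close> modulo the kernel of
  \<open>q\<close>. It is unique because \<open>q\<close> is the modulus on scalars, and uniqueness
  yields every algebraic law.\<close>

lemma minimal_functional: "\<exists>f\<in>mult_functionals smul. \<forall>x. cmod (f x) \<le> q x"
proof -
  obtain f where f: "\<And>a. q (a - f a *\<^sub>C 1) = 0" using minimal_scalar_approx by metis
  have zero_add: "q (x + y) = 0" if "q x = 0" "q y = 0" for x y
    using that minimal_simps(1,2)[of "x + y"] minimal_simps(2)[of x y] by simp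
  have f_eq: "f a = z" if "q (a - z *\<^sub>C 1) = 0" for a z
  proof -
    have "q (- (a - f a *\<^sub>C 1)) = 0"
      using minimal_simps(3)[of "-1" "a - f a *\<^sub>C 1"] f[of a] by simp
    from zero_add[OF this that] have "q ((f a - z) *\<^sub>C 1) = 0"
      by (simp add: scale_left_diff_distrib)
    then show ?thesis by (simp only: minimal_of_scalar) simp
  qed
  have add: "f (x + y) = f x + f y" for x y
    using zero_add[OF f[of x] f[of y]] by (intro f_eq) (simp add: scale_left_distrib algebra_simps)
  have smul: "f (c *\<^sub>C x) = c * f x" for c x
    using minimal_simps(3)[of c "x - f x *\<^sub>C 1"] f[of x]
    by (intro f_eq) (simp add: scale_right_diff_distrib)
  have mult: "f (x * y) = f x * f y" for x y
  proof (rule f_eq)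
    have "x * y - (f x * f y) *\<^sub>C 1 = (x - f x *\<^sub>C 1) * y + f x *\<^sub>C (y - f y *\<^sub>C 1)"
      by (simp add: scale_right_diff_distrib left_diff_distrib scale_mult_left)
    then show "q (x * y - (f x * f y) *\<^sub>C 1) = 0"
      using zero_add[of "(x - f x *\<^sub>C 1) * y" "f x *\<^sub>C (y - f y *\<^sub>C 1)"]
      by (simp add: minimal_mult f minimal_simps(3))
  qed
  have one: "f 1 = 1" by (rule f_eq) (simp add: minimal_simps(3)[of 0 1, simplified])
  have "vector_space ((*) :: complex \<Rightarrow> complex \<Rightarrow> complex)"
    by unfold_locales (auto simp: algebra_simps)
  then have "Vector_Spaces.linear smul (*) f"
    using vector_space_axioms add smul by (simp add: Vector_Spaces.linear_iff)
  then have "f \<in> mult_functionals smul"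
    unfolding mult_functionals_def using mult one by (auto intro: exI[of _ 1])
  moreover have "cmod (f x) \<le> q x" for x
  proof -
    have "q (- (x - f x *\<^sub>C 1)) = 0"
      using minimal_simps(3)[of "-1" "x - f x *\<^sub>C 1"] f[of x] by simp
    then show ?thesis
      using minimal_simps(2)[of "- (x - f x *\<^sub>C 1)" x] minimal_of_scalar[of "f x"] by simp
  qed
  ultimately show ?thesis by blast
qed

end

lemma exists_bounded_mult_functional:
  assumes "submult_seminorm smul p" "p 1 = 1"
  shows "\<exists>f\<in>mult_functionals smul. \<forall>x. cmod (f x) \<le> p x"
proof -
  obtain q where "minimal_seminorm q" "q \<le> p" using exists_minimal_seminorm[OF assms] by blast
  then show ?thesis using minimal_functional by (meson le_funD order_trans)
qed

end

section \<open>Commutativity and the equivalence\<close>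

lemma mult_commute_of_unit_functionals:
  fixes smul :: "complex \<Rightarrow> 'a::ring_1 \<Rightarrow> 'a"
  assumes "topological_algebra smul T" "topology_defined_by T P"
    and sn: "\<And>p. p \<in> P \<Longrightarrow> submult_seminorm smul p"
    and unit: "\<And>x p. p \<in> P \<Longrightarrow> p x = 1 \<Longrightarrow> \<exists>f\<in>mult_functionals smul. cmod (f x) = 1"
  shows "x * y = y * (x::'a)"
proof (rule topology_defined_by_separates[OF assms(2)])
  show "Hausdorff_space T" "topspace T = UNIV"
    using assms(1) by (auto simp: topological_algebra_def topological_algebra_axioms_def)
  fix p assume p: "p \<in> P"
  show "p (y * x - x * y) = 0"
  proof (rule ccontr)
    let ?z = "y * x - x * y"
    assume nz: "p ?z \<noteq> 0"
    \<comment> \<open>Scaling the commutator to seminorm \<open>1\<close> yields a functional of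
      modulus \<open>1\<close> there, yet multiplicative functionals annihilate commutators.\<close>
    then have "p (smul (of_real (inverse (p ?z))) ?z) = 1"
      using submult_seminormD(1)[OF sn[OF p], of ?z] submult_seminormD(3)[OF sn[OF p]]
      by (simp add: norm_inverse)
    then obtain f where f: "f \<in> mult_functionals smul"
        "cmod (f (smul (of_real (inverse (p ?z))) ?z)) = 1" using unit p by blast
    then have lin: "Vector_Spaces.linear smul (*) f" and mult: "\<And>u v. f (u * v) = f u * f v"
      by (auto simp: mult_functionals_def)
    interpret f: Vector_Spaces.linear smul "(*)" f by (rule lin)
    show False using f(2) by (simp add: f.scale f.diff mult)
  qed
qed

theorem theorem2p2:
  fixes smul :: "complex \<Rightarrow> 'a::ring_1 \<Rightarrow> 'a" and T :: "'a topology"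
  assumes "topological_algebra smul T"
  shows "saturated_lmc_algebra smul T \<longleftrightarrow>
    (\<exists>P. (\<forall>p\<in>P. submult_seminorm smul p) \<and> topology_defined_by T P \<and>
      (\<forall>p\<in>P. p 1 = 1) \<and>
      (\<forall>x. \<forall>p\<in>P. p x = 1 \<longrightarrow> (\<exists>f\<^sub>0\<in>mult_functionals smul. cmod (f\<^sub>0 x) = 1)))"
    (is "_ \<longleftrightarrow> (\<exists>P. ?sn P \<and> ?top P \<and> ?one P \<and> ?unit P)")
proof
  assume "saturated_lmc_algebra smul T"
  then obtain P where P: "?sn P" "?top P" "?one P"
    and sat: "\<And>x p. p \<in> P \<Longrightarrow> p x = 1 \<Longrightarrow>
      \<exists>f\<^sub>0\<in>mult_functionals smul. \<exists>f\<in>mult_functionals smul.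
        ereal (cmod (f\<^sub>0 x)) = (SUP y\<in>{y. p y \<le> 1}. ereal (cmod (f y)))"
    unfolding saturated_lmc_algebra_def by blast
  have "?unit P"
  proof (intro allI ballI impI)
    fix x p assume p: "p \<in> P" "p x = 1"
    then obtain f\<^sub>0 f where f: "f\<^sub>0 \<in> mult_functionals smul" "f \<in> mult_functionals smul"
      and sup: "ereal (cmod (f\<^sub>0 x)) = (SUP y\<in>{y. p y \<le> 1}. ereal (cmod (f y)))"
      using sat by blast
    \<comment> \<open>The supremum equals a real number, so \<open>f\<close> is bounded on the unit
      ball; powers then improve the bound to \<open>1\<close>.\<close>
    have "cmod (f y) \<le> cmod (f\<^sub>0 x)" if "p y \<le> 1" for y
      using that SUP_upper[of y "{y. p y \<le> 1}" "\<lambda>y. ereal (cmod (f y))"] by (simp flip: sup)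
    then have "cmod (f y) \<le> 1" if "p y \<le> 1" for y
      using mult_functional_cmod_le_one[OF f(2), of p] P(1,3) p(1) that by blast
    then have "ereal (cmod (f\<^sub>0 x)) = 1"
      unfolding sup using mult_functional_SUP_unit_ball[OF f(2), of p] P(3) p(1) by blast
    then show "\<exists>f\<^sub>0\<in>mult_functionals smul. cmod (f\<^sub>0 x) = 1" using f(1) by auto
  qed
  with P show "\<exists>P. ?sn P \<and> ?top P \<and> ?one P \<and> ?unit P" by blast
next
  assume "\<exists>P. ?sn P \<and> ?top P \<and> ?one P \<and> ?unit P"
  then obtain P where P: "?sn P" "?top P" "?one P" "?unit P" by blast
  interpret topological_algebra smul T by (rule assms)
  interpret commutative_complex_algebra smul
    using mult_commute_of_unit_functionals[OF assms P(2)] P by unfold_locales blast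
  \<comment> \<open>An empty family would identify \<open>1\<close> with \<open>0\<close>.\<close>
  have "P \<noteq> {}"
    using topology_defined_by_separates[OF P(2) Hausdorff topspace_UNIV, of 1 0] by auto
  then have "mult_functionals smul \<noteq> {}" using P(3,4) by blast
  moreover have "\<exists>f\<^sub>0\<in>mult_functionals smul. \<exists>f\<in>mult_functionals smul.
      ereal (cmod (f\<^sub>0 x)) = (SUP y\<in>{y. p y \<le> 1}. ereal (cmod (f y)))"
    if p: "p \<in> P" "p x = 1" for x p
  proof -
    \<comment> \<open>\<open>f\<^sub>0\<close> depends on \<open>x\<close>, while \<open>f\<close>
      depends only on \<open>p\<close> and has supremum \<open>1\<close> over the unit ball because
      \<open>p\<close> dominates it.\<close>
    obtain f\<^sub>0 where f0: "f\<^sub>0 \<in> mult_functionals smul" "cmod (f\<^sub>0 x) = 1" using P(4) p by blast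
    obtain f where f: "f \<in> mult_functionals smul" "\<And>y. cmod (f y) \<le> p y"
      using exists_bounded_mult_functional[of p] P(1,3) p(1) by blast
    then have "(SUP y\<in>{y. p y \<le> 1}. ereal (cmod (f y))) = 1"
      using mult_functional_SUP_unit_ball[OF f(1), of p] P(3) p(1) by (meson order_trans)
    then show ?thesis using f0 f(1) by (metis one_ereal_def)
  qed
  ultimately show "saturated_lmc_algebra smul T"
    unfolding saturated_lmc_algebra_def using assms P(1-3) by blast
qed

end
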